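(* Let $A$ be a separable C*-algebra and let $L$ be a seminorm defined on a norm-dense subspace $\operatorname{dom}L$ of the self-adjoint part of $A$. Let $\alpha,\beta>0$. The $(\alpha,\beta)$-bounded-Lipschitz metric defined on the state space $S(A)$ of $A$ by $$d_{L,\alpha,\beta}(\varphi,\psi)=\sup\{|\varphi(a)-\psi(a)|: a\in\operatorname{dom}L,\ L(a)\leq\beta,\ \|a\|\leq\alpha\}$$ is equivalent to the bounded-Lipschitz metric $d_L=d_{L,1,1}$, that is, there are constants $c,C>0$ such that $c\,d_L\leq d_{L,\alpha,\beta}\leq C\,d_L$ on $S(A)\times S(A)$. Consequently, $d_{L,\alpha,\beta}$ metrizes the weak* topology on $S(A)$ if and only if $L$ is a quasi-Lip-norm.
   Context: The bounded-Lipschitz metric is $d_L(\varphi,\psi)=\sup\{|\varphi(a)-\psi(a)|: a\in\operatorname{dom}L,\ L(a)\leq 1,\ \|a\|\leq 1\}$ for $\varphi,\psi\in S(A)$. A quasi-Lip-norm on a separable C*-algebra $A$ is a seminorm $L$ defined on a norm-dense subspace of the self-adjoint part of $A$ such that the topology induced by $d_L$ on $S(A)$ is the weak* topology of $S(A)$. *)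

theory Defs
  imports "HOL-Analysis.Analysis"
begin

text \<open>C*-algebras, not necessarily unital. The library's type classes for algebras and Banach
  spaces are real, so the complex scalar multiplication is added as an operation extending the
  real one.\<close>

class cstar_algebra = real_normed_algebra + banach +
  fixes scaleC :: "complex \<Rightarrow> 'a \<Rightarrow> 'a"  (infixr \<open>*\<^sub>C\<close> 75)
    and star :: "'a \<Rightarrow> 'a"
  assumes scaleC_of_real: "of_real r *\<^sub>C x = r *\<^sub>R x"
    and scaleC_add_right: "c *\<^sub>C (x + y) = c *\<^sub>C x + c *\<^sub>C y"
    and scaleC_add_left: "(c + d) *\<^sub>C x = c *\<^sub>C x + d *\<^sub>C x"
    and scaleC_scaleC: "c *\<^sub>C d *\<^sub>C x = (c * d) *\<^sub>C x"
    and mult_scaleC_left: "(c *\<^sub>C x) * y = c *\<^sub>C (x * y)"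
    and mult_scaleC_right: "x * (c *\<^sub>C y) = c *\<^sub>C (x * y)"
    and norm_scaleC: "norm (c *\<^sub>C x) = cmod c * norm x"
    and star_star: "star (star x) = x"
    and star_add: "star (x + y) = star x + star y"
    and star_scaleC: "star (c *\<^sub>C x) = cnj c *\<^sub>C star x"
    and star_mult: "star (x * y) = star y * star x"
    and cstar_identity: "norm (star x * x) = (norm x)\<^sup>2"

definition self_adjoint :: "'a::cstar_algebra set" where
  "self_adjoint = {a. star a = a}"

text \<open>States: positive complex-linear functionals of norm one. Elements of the type
  \<open>'a \<Rightarrow>\<^sub>L complex\<close> are only real-linear and bounded, hence the homogeneity clause.\<close>

definition states :: "('a::cstar_algebra \<Rightarrow>\<^sub>L complex) set" where
  "states = {\<phi>. (\<forall>c x. blinfun_apply \<phi> (c *\<^sub>C x) = c * blinfun_apply \<phi> x)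
                \<and> (\<forall>a. blinfun_apply \<phi> (star a * a) \<in> \<real>\<^sub>\<ge>\<^sub>0)
                \<and> norm \<phi> = 1}"

text \<open>On scalar-valued operators the strong operator topology is the topology of pointwise
  convergence, that is, the weak* topology.\<close>

definition weak_star_states :: "('a::cstar_algebra \<Rightarrow>\<^sub>L complex) topology" where
  "weak_star_states = subtopology strong_operator_topology states"

text \<open>A seminorm \<open>L\<close> with domain \<open>D\<close>, a norm-dense real subspace of the self-adjoint part;
  the values of \<open>L\<close> outside \<open>D\<close> are irrelevant.\<close>

definition dense_seminorm :: "'a::cstar_algebra set \<Rightarrow> ('a \<Rightarrow> real) \<Rightarrow> bool" where
  "dense_seminorm D L \<longleftrightarrow>
     subspace D \<and> D \<subseteq> self_adjoint \<and> self_adjoint \<subseteq> closure D \<and>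
     (\<forall>a\<in>D. 0 \<le> L a) \<and>
     (\<forall>a\<in>D. \<forall>r. L (r *\<^sub>R a) = \<bar>r\<bar> * L a) \<and>
     (\<forall>a\<in>D. \<forall>b\<in>D. L (a + b) \<le> L a + L b)"

text \<open>For \<open>\<alpha>, \<beta> \<ge> 0\<close> the supremum is over a nonempty set bounded by
  \<open>norm (\<phi> - \<psi>) * \<alpha>\<close>, so the real-valued supremum is the intended one.\<close>

definition bl_metric ::
    "'a::cstar_algebra set \<Rightarrow> ('a \<Rightarrow> real) \<Rightarrow> real \<Rightarrow> real \<Rightarrow>
     ('a \<Rightarrow>\<^sub>L complex) \<Rightarrow> ('a \<Rightarrow>\<^sub>L complex) \<Rightarrow> real" where
  "bl_metric D L \<alpha> \<beta> \<phi> \<psi> =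
     (SUP a\<in>{a\<in>D. L a \<le> \<beta> \<and> norm a \<le> \<alpha>}. cmod (blinfun_apply \<phi> a - blinfun_apply \<psi> a))"

definition quasi_Lip_norm :: "'a::cstar_algebra set \<Rightarrow> ('a \<Rightarrow> real) \<Rightarrow> bool" where
  "quasi_Lip_norm D L \<longleftrightarrow>
     dense_seminorm D L \<and>
     Metric_space.mtopology states (bl_metric D L 1 1) = weak_star_states"

end

theory Submission
  imports Defs
begin

text \<open>
  The seminorm \<open>L\<close> and the norm are both homogeneous. Rescaling an element by \<open>r\<close> therefore moves
  it from the test set \<open>L a \<le> \<beta>'\<close>, \<open>norm a \<le> \<alpha>'\<close> into the test set \<open>L a \<le> \<beta>\<close>, \<open>norm a \<le> \<alpha>\<close>
  as soon as \<open>r * \<alpha>' \<le> \<alpha>\<close> and \<open>r * \<beta>' \<le> \<beta>\<close>, and it multiplies \<open>cmod (\<phi> a - \<psi> a)\<close> by \<open>r\<close>. This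
  gives \<open>r * d' \<le> d\<close> for the two suprema (\<open>bl_metric_rescale\<close>), and taking \<open>r\<close> to be a minimum of
  ratios of the parameters, once in each direction, gives both constants. Two metrics that bound
  each other up to constants have the same open sets (\<open>mtopology_eq_if_equivalent\<close>), so one of
  them induces the weak* topology exactly when the other does.

  That the functions are metrics at all rests on the density of the domain of \<open>L\<close>. Rescaling
  shows that states at distance zero agree on the whole domain, hence by continuity on the
  self-adjoint part, hence everywhere, because each element is \<open>h + \<i> k\<close> with \<open>h\<close> and \<open>k\<close>
  self-adjoint.
\<close>

section \<open>Lipschitz-equivalent metrics\<close>

lemma openin_mtopology_if_dominated:
  assumes "Metric_space M d" and "Metric_space M d'" and "c > 0"
    and dom: "\<And>x y. x \<in> M \<Longrightarrow> y \<in> M \<Longrightarrow> c * d x y \<le> d' x y"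
    and U: "openin (Metric_space.mtopology M d) U"
  shows "openin (Metric_space.mtopology M d') U"
proof -
  interpret d: Metric_space M d by fact
  interpret d': Metric_space M d' by fact
  have "U \<subseteq> M"
    using U by (simp add: d.openin_mtopology)
  moreover have "\<exists>r>0. d'.mball x r \<subseteq> U" if "x \<in> U" for x
  proof -
    obtain r where r: "r > 0" "d.mball x r \<subseteq> U"
      using U \<open>x \<in> U\<close> by (auto simp: d.openin_mtopology)
    have "d'.mball x (c * r) \<subseteq> d.mball x r"
    proof
      fix y assume "y \<in> d'.mball x (c * r)"
      then have xy: "x \<in> M" "y \<in> M" "d' x y < c * r" by auto
      then have "c * d x y < c * r" using dom[of x y] by linarith
      then show "y \<in> d.mball x r" using xy \<open>c > 0\<close> by simp
    qed
    then show ?thesis using r \<open>c > 0\<close> by (intro exI[of _ "c * r"]) auto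
  qed
  ultimately show ?thesis by (simp add: d'.openin_mtopology)
qed

lemma mtopology_eq_if_equivalent:
  assumes "Metric_space M d" and "Metric_space M d'" and "c > 0" and "C > 0"
    and lower: "\<And>x y. x \<in> M \<Longrightarrow> y \<in> M \<Longrightarrow> c * d x y \<le> d' x y"
    and upper: "\<And>x y. x \<in> M \<Longrightarrow> y \<in> M \<Longrightarrow> d' x y \<le> C * d x y"
  shows "Metric_space.mtopology M d' = Metric_space.mtopology M d"
proof -
  have "inverse C * d' x y \<le> d x y" if "x \<in> M" "y \<in> M" for x y
    using upper[OF that] \<open>C > 0\<close> by (simp add: field_simps)
  then show ?thesis
    unfolding topology_eq
    using openin_mtopology_if_dominated[OF assms(1,2) \<open>c > 0\<close> lower]
      openin_mtopology_if_dominated[OF assms(2,1), of "inverse C"] \<open>C > 0\<close>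
    by auto
qed

section \<open>States are determined by their values on a dense part of the self-adjoint elements\<close>

lemma self_adjoint_decomposition:
  fixes x :: "'a::cstar_algebra"
  obtains h k where "h \<in> self_adjoint" "k \<in> self_adjoint" "x = h + \<i> *\<^sub>C k"
proof
  \<comment> \<open>The real and imaginary parts \<open>(x + x\<^sup>*) / 2\<close> and \<open>(x - x\<^sup>*) / (2 \<i>)\<close>, written as sums of
    scalar multiples so that the axioms for \<open>scaleC\<close> apply directly.\<close>
  define h where "h = (1/2) *\<^sub>C x + (1/2) *\<^sub>C star x"
  define k where "k = (-\<i>/2) *\<^sub>C x + (\<i>/2) *\<^sub>C star x"
  show "h \<in> self_adjoint" "k \<in> self_adjoint"
    by (simp_all add: h_def k_def self_adjoint_def star_add star_scaleC star_star add.commute)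
  have "\<i> *\<^sub>C k = (1/2) *\<^sub>C x + (-1/2) *\<^sub>C star x"
    by (simp add: k_def scaleC_add_right scaleC_scaleC)
  then have "h + \<i> *\<^sub>C k = ((1/2) *\<^sub>C x + (1/2) *\<^sub>C x) + ((1/2) *\<^sub>C star x + (-1/2) *\<^sub>C star x)"
    by (simp add: h_def algebra_simps)
  also have "\<dots> = (1/2 + 1/2) *\<^sub>C x + (1/2 + -1/2) *\<^sub>C star x"
    by (simp only: scaleC_add_left)
  also have "\<dots> = x"
    using scaleC_of_real[of 1 x] scaleC_of_real[of 0 "star x"] by simp
  finally show "x = h + \<i> *\<^sub>C k" ..
qed

lemma states_eqI:
  fixes \<phi> \<psi> :: "'a::cstar_algebra \<Rightarrow>\<^sub>L complex"
  assumes "\<phi> \<in> states" "\<psi> \<in> states"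
    and dense: "self_adjoint \<subseteq> closure D"
    and agree: "\<And>a. a \<in> D \<Longrightarrow> blinfun_apply \<phi> a = blinfun_apply \<psi> a"
  shows "\<phi> = \<psi>"
proof (rule blinfun_eqI)
  have "closed {a. blinfun_apply \<phi> a = blinfun_apply \<psi> a}"
    by (intro closed_Collect_eq continuous_intros)
  then have "closure D \<subseteq> {a. blinfun_apply \<phi> a = blinfun_apply \<psi> a}"
    using agree by (intro closure_minimal) auto
  then have sa: "blinfun_apply \<phi> a = blinfun_apply \<psi> a" if "a \<in> self_adjoint" for a
    using dense that by auto
  fix x :: 'a
  obtain h k where "h \<in> self_adjoint" "k \<in> self_adjoint" "x = h + \<i> *\<^sub>C k"
    by (rule self_adjoint_decomposition)
  then show "blinfun_apply \<phi> x = blinfun_apply \<psi> x"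
    using assms(1,2) sa by (simp add: states_def blinfun.add_right)
qed

section \<open>The bounded-Lipschitz metrics\<close>

lemma dense_seminorm_zero:
  assumes "dense_seminorm D L"
  shows "0 \<in> D" and "L 0 = 0"
proof -
  show "0 \<in> D"
    using assms by (simp add: dense_seminorm_def subspace_0)
  moreover have "\<forall>a\<in>D. \<forall>r. L (r *\<^sub>R a) = \<bar>r\<bar> * L a"
    using assms by (simp add: dense_seminorm_def)
  ultimately have "L (0 *\<^sub>R (0::'a)) = \<bar>0\<bar> * L 0" by blast
  then show "L 0 = 0" by simp
qed

lemma bl_metric_bdd_above:
  "bdd_above ((\<lambda>a. cmod (blinfun_apply \<phi> a - blinfun_apply \<psi> a)) ` {a \<in> D. L a \<le> \<beta> \<and> norm a \<le> \<alpha>})"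
proof (rule bdd_aboveI2)
  fix a assume "a \<in> {a \<in> D. L a \<le> \<beta> \<and> norm a \<le> \<alpha>}"
  then have "norm (\<phi> - \<psi>) * norm a \<le> norm (\<phi> - \<psi>) * \<alpha>"
    by (simp add: mult_left_mono)
  then show "cmod (blinfun_apply \<phi> a - blinfun_apply \<psi> a) \<le> norm (\<phi> - \<psi>) * \<alpha>"
    using norm_blinfun[of "\<phi> - \<psi>" a] by (simp add: blinfun.diff_left)
qed

lemma bl_metric_upper:
  assumes "a \<in> D" "L a \<le> \<beta>" "norm a \<le> \<alpha>"
  shows "cmod (blinfun_apply \<phi> a - blinfun_apply \<psi> a) \<le> bl_metric D L \<alpha> \<beta> \<phi> \<psi>"
  unfolding bl_metric_def using assms
  by (intro cSUP_upper bl_metric_bdd_above) simp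

lemma bl_metric_least:
  assumes "dense_seminorm D L" "\<alpha> \<ge> 0" "\<beta> \<ge> 0"
    and "\<And>a. a \<in> D \<Longrightarrow> L a \<le> \<beta> \<Longrightarrow> norm a \<le> \<alpha> \<Longrightarrow>
      cmod (blinfun_apply \<phi> a - blinfun_apply \<psi> a) \<le> B"
  shows "bl_metric D L \<alpha> \<beta> \<phi> \<psi> \<le> B"
proof -
  have "0 \<in> {a \<in> D. L a \<le> \<beta> \<and> norm a \<le> \<alpha>}"
    using assms(2,3) dense_seminorm_zero[OF assms(1)] by simp
  then show ?thesis
    unfolding bl_metric_def by (intro cSUP_least) (use assms(4) in auto)
qed

text \<open>The map \<open>a \<mapsto> r a\<close> carries the test set of the left-hand metric into that of the
  right-hand one, and it scales the differences \<open>\<phi> a - \<psi> a\<close> by \<open>r\<close>.\<close>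

lemma bl_metric_rescale:
  assumes D: "dense_seminorm D L" and "\<alpha>' \<ge> 0" "\<beta>' \<ge> 0"
    and "r > 0" "r * \<alpha>' \<le> \<alpha>" "r * \<beta>' \<le> \<beta>"
  shows "r * bl_metric D L \<alpha>' \<beta>' \<phi> \<psi> \<le> bl_metric D L \<alpha> \<beta> \<phi> \<psi>"
proof -
  have "bl_metric D L \<alpha>' \<beta>' \<phi> \<psi> \<le> bl_metric D L \<alpha> \<beta> \<phi> \<psi> / r"
  proof (rule bl_metric_least[OF D \<open>\<alpha>' \<ge> 0\<close> \<open>\<beta>' \<ge> 0\<close>])
    fix a assume a: "a \<in> D" "L a \<le> \<beta>'" "norm a \<le> \<alpha>'"
    have "r *\<^sub>R a \<in> D" "L (r *\<^sub>R a) = r * L a"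
      using D a \<open>r > 0\<close> by (simp_all add: dense_seminorm_def subspace_scale)
    moreover have "r * L a \<le> \<beta>"
      using mult_left_mono[OF a(2), of r] assms(4,6) by linarith
    moreover have "norm (r *\<^sub>R a) \<le> \<alpha>"
      using order_trans[OF mult_left_mono[OF a(3), of r] assms(5)] assms(4) by simp
    ultimately have
      "cmod (blinfun_apply \<phi> (r *\<^sub>R a) - blinfun_apply \<psi> (r *\<^sub>R a)) \<le> bl_metric D L \<alpha> \<beta> \<phi> \<psi>"
      by (intro bl_metric_upper) simp_all
    moreover have "cmod (blinfun_apply \<phi> (r *\<^sub>R a) - blinfun_apply \<psi> (r *\<^sub>R a)) =
        r * cmod (blinfun_apply \<phi> a - blinfun_apply \<psi> a)"
      using \<open>r > 0\<close> by (simp add: blinfun.scaleR_right flip: scaleR_diff_right)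
    ultimately show "cmod (blinfun_apply \<phi> a - blinfun_apply \<psi> a) \<le> bl_metric D L \<alpha> \<beta> \<phi> \<psi> / r"
      using \<open>r > 0\<close> by (simp add: field_simps)
  qed
  then show ?thesis
    using \<open>r > 0\<close> by (simp add: field_simps)
qed

lemma bl_metric_eq_0_imp_eq_on_domain:
  assumes D: "dense_seminorm D L" and "\<alpha> > 0" "\<beta> > 0"
    and zero: "bl_metric D L \<alpha> \<beta> \<phi> \<psi> = 0" and "a \<in> D"
  shows "blinfun_apply \<phi> a = blinfun_apply \<psi> a"
proof -
  \<comment> \<open>The test set with parameters \<open>norm a\<close> and \<open>L a\<close> contains \<open>a\<close>; the \<open>1\<close> in each denominator
    below covers the case that one of them is zero.\<close>
  define r where "r = min (\<alpha> / (norm a + 1)) (\<beta> / (L a + 1))"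
  have La: "L a \<ge> 0"
    using D \<open>a \<in> D\<close> by (simp add: dense_seminorm_def)
  have na: "norm a + 1 > 0"
    using norm_ge_zero[of a] by linarith
  have "r > 0"
    using La na \<open>\<alpha> > 0\<close> \<open>\<beta> > 0\<close> by (simp add: r_def)
  moreover have "r * norm a \<le> \<alpha>"
  proof -
    have "r * norm a \<le> r * (norm a + 1)"
      using \<open>r > 0\<close> by simp
    also have "\<dots> \<le> \<alpha> / (norm a + 1) * (norm a + 1)"
      using na by (intro mult_right_mono) (simp_all add: r_def)
    finally show ?thesis using na by simp
  qed
  moreover have "r * L a \<le> \<beta>"
  proof -
    have "r * L a \<le> r * (L a + 1)"
      using \<open>r > 0\<close> by simp
    also have "\<dots> \<le> \<beta> / (L a + 1) * (L a + 1)"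
      using La by (intro mult_right_mono) (simp_all add: r_def)
    finally show ?thesis using La by simp
  qed
  ultimately have "r * bl_metric D L (norm a) (L a) \<phi> \<psi> \<le> 0"
    using bl_metric_rescale[OF D norm_ge_zero La, of r a \<alpha> \<beta> \<phi> \<psi>] zero by simp
  then have "bl_metric D L (norm a) (L a) \<phi> \<psi> \<le> 0"
    using \<open>r > 0\<close> by (simp add: mult_le_0_iff)
  moreover have "cmod (blinfun_apply \<phi> a - blinfun_apply \<psi> a) \<le> bl_metric D L (norm a) (L a) \<phi> \<psi>"
    using \<open>a \<in> D\<close> by (intro bl_metric_upper) auto
  ultimately have "cmod (blinfun_apply \<phi> a - blinfun_apply \<psi> a) \<le> 0"
    by linarith
  then show ?thesis by simp
qed

lemma Metric_space_bl_metric: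
  assumes D: "dense_seminorm D L" and "\<alpha> > 0" "\<beta> > 0"
  shows "Metric_space states (bl_metric D L \<alpha> \<beta>)"
proof
  fix \<phi> \<psi> \<omega> :: "'a \<Rightarrow>\<^sub>L complex"
  show "0 \<le> bl_metric D L \<alpha> \<beta> \<phi> \<psi>"
    using bl_metric_upper[of 0 D L \<beta> \<alpha> \<phi> \<psi>] dense_seminorm_zero[OF D] assms(2,3)
    by (simp add: blinfun.zero_right)
  show "bl_metric D L \<alpha> \<beta> \<phi> \<psi> = bl_metric D L \<alpha> \<beta> \<psi> \<phi>"
    by (simp add: bl_metric_def norm_minus_commute)
  assume \<phi>\<psi>: "\<phi> \<in> states" "\<psi> \<in> states"
  show "bl_metric D L \<alpha> \<beta> \<phi> \<psi> = 0 \<longleftrightarrow> \<phi> = \<psi>"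
  proof
    assume "bl_metric D L \<alpha> \<beta> \<phi> \<psi> = 0"
    moreover have "self_adjoint \<subseteq> closure D"
      using D by (simp add: dense_seminorm_def)
    ultimately show "\<phi> = \<psi>"
      using \<phi>\<psi> bl_metric_eq_0_imp_eq_on_domain[OF D \<open>\<alpha> > 0\<close> \<open>\<beta> > 0\<close>] by (intro states_eqI) auto
  next
    assume "\<phi> = \<psi>"
    moreover have "bl_metric D L \<alpha> \<beta> \<psi> \<psi> \<le> 0"
      using assms by (intro bl_metric_least[OF D]) auto
    ultimately show "bl_metric D L \<alpha> \<beta> \<phi> \<psi> = 0"
      using \<open>0 \<le> bl_metric D L \<alpha> \<beta> \<phi> \<psi>\<close> by simp
  qed
  show "bl_metric D L \<alpha> \<beta> \<phi> \<omega> \<le> bl_metric D L \<alpha> \<beta> \<phi> \<psi> + bl_metric D L \<alpha> \<beta> \<psi> \<omega>"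
  proof (rule bl_metric_least[OF D])
    fix a assume a: "a \<in> D" "L a \<le> \<beta>" "norm a \<le> \<alpha>"
    have "cmod (blinfun_apply \<phi> a - blinfun_apply \<omega> a) \<le>
        cmod (blinfun_apply \<phi> a - blinfun_apply \<psi> a) + cmod (blinfun_apply \<psi> a - blinfun_apply \<omega> a)"
      using norm_triangle_ineq[of "blinfun_apply \<phi> a - blinfun_apply \<psi> a"
          "blinfun_apply \<psi> a - blinfun_apply \<omega> a"] by simp
    also have "\<dots> \<le> bl_metric D L \<alpha> \<beta> \<phi> \<psi> + bl_metric D L \<alpha> \<beta> \<psi> \<omega>"
      using a by (intro add_mono bl_metric_upper)
    finally show "cmod (blinfun_apply \<phi> a - blinfun_apply \<omega> a) \<le>
        bl_metric D L \<alpha> \<beta> \<phi> \<psi> + bl_metric D L \<alpha> \<beta> \<psi> \<omega>" .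
  qed (use assms in auto)
qed

theorem proposition2p10:
  fixes D :: "'a::cstar_algebra set" and L :: "'a \<Rightarrow> real" and \<alpha> \<beta> :: real
  assumes "separable_space (euclidean :: 'a topology)"
    and "dense_seminorm D L"
    and "\<alpha> > 0" and "\<beta> > 0"
  shows "Metric_space states (bl_metric D L \<alpha> \<beta>) \<and>
    (\<exists>c>0. \<exists>C>0. \<forall>\<phi>\<in>states. \<forall>\<psi>\<in>states.
        c * bl_metric D L 1 1 \<phi> \<psi> \<le> bl_metric D L \<alpha> \<beta> \<phi> \<psi> \<and>
        bl_metric D L \<alpha> \<beta> \<phi> \<psi> \<le> C * bl_metric D L 1 1 \<phi> \<psi>) \<and>
    (Metric_space.mtopology states (bl_metric D L \<alpha> \<beta>) = weak_star_states \<longleftrightarrow>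
      quasi_Lip_norm D L)"
proof -
  note D = \<open>dense_seminorm D L\<close>
  have metric: "Metric_space states (bl_metric D L \<alpha> \<beta>)"
    using assms by (intro Metric_space_bl_metric)
  have metric1: "Metric_space states (bl_metric D L 1 1)"
    using D by (intro Metric_space_bl_metric) auto
  define c where "c = min \<alpha> \<beta>"
  define C where "C = max \<alpha> \<beta>"
  have c: "c > 0" and C: "C > 0"
    using assms by (auto simp: c_def C_def)
  have lower: "c * bl_metric D L 1 1 \<phi> \<psi> \<le> bl_metric D L \<alpha> \<beta> \<phi> \<psi>" for \<phi> \<psi>
    using c by (intro bl_metric_rescale[OF D]) (auto simp: c_def)
  have upper: "bl_metric D L \<alpha> \<beta> \<phi> \<psi> \<le> C * bl_metric D L 1 1 \<phi> \<psi>" for \<phi> \<psi>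
  proof -
    have "inverse C * bl_metric D L \<alpha> \<beta> \<phi> \<psi> \<le> bl_metric D L 1 1 \<phi> \<psi>"
      using C assms by (intro bl_metric_rescale[OF D]) (auto simp: C_def field_simps)
    then show ?thesis using C by (simp add: field_simps)
  qed
  have "Metric_space.mtopology states (bl_metric D L \<alpha> \<beta>) =
      Metric_space.mtopology states (bl_metric D L 1 1)"
    using mtopology_eq_if_equivalent[OF metric1 metric c C] lower upper by blast
  moreover have "\<exists>c>0. \<exists>C>0. \<forall>\<phi>\<in>states. \<forall>\<psi>\<in>states.
      c * bl_metric D L 1 1 \<phi> \<psi> \<le> bl_metric D L \<alpha> \<beta> \<phi> \<psi> \<and>
      bl_metric D L \<alpha> \<beta> \<phi> \<psi> \<le> C * bl_metric D L 1 1 \<phi> \<psi>"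
    using c C lower upper by blast
  ultimately show ?thesis
    using metric D by (simp add: quasi_Lip_norm_def)
qed

end
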